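(* Let $k\ge 2$ be an integer. If $G$ is a $C_{2k}$-free bipartite graph with $\Delta(G)\ge 1$, then $\omega'_S(G)\le k\Delta(G)-(k-1)$.
   Context: All graphs are finite and simple. $\Delta(G)$ is the maximum degree of $G$. $C_n$ denotes the cycle on $n$ vertices; a graph is $F$-free if it contains no subgraph (not necessarily induced) isomorphic to $F$. The distance between two edges $e_1,e_2$ of $G$ is the distance between the vertices corresponding to $e_1,e_2$ in the line graph of $G$; thus two distinct edges are at distance at most $2$ iff they share an endpoint or some edge of $G$ joins an endpoint of one to an endpoint of the other. A strong clique of $G$ is a set $S$ of edges of $G$ such that every pair of edges in $S$ has distance at most $2$. The strong clique number $\omega'_S(G)$ is the maximum size of a strong clique of $G$. *)

theory Defs
  imports Main "HOL-Library.Extended_Nat"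
begin

record 'a ugraph =
  verts :: "'a set"
  edges :: "'a set set"

definition simple_graph :: "'a ugraph \<Rightarrow> bool" where
  "simple_graph G \<longleftrightarrow>
     finite (verts G) \<and> (\<forall>e\<in>edges G. e \<subseteq> verts G \<and> card e = 2)"

definition degree :: "'a ugraph \<Rightarrow> 'a \<Rightarrow> nat" where
  "degree G v = card {e \<in> edges G. v \<in> e}"

(* The inserted 0 only matters for the graph without vertices. *)
definition max_degree :: "'a ugraph \<Rightarrow> nat" where
  "max_degree G = Max (insert 0 (degree G ` verts G))"

definition bipartite :: "'a ugraph \<Rightarrow> bool" where
  "bipartite G \<longleftrightarrow>
     (\<exists>A B. A \<union> B = verts G \<and> A \<inter> B = {} \<and>
            (\<forall>e\<in>edges G. \<exists>a\<in>A. \<exists>b\<in>B. e = {a, b}))"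

definition subgraph :: "'a ugraph \<Rightarrow> 'a ugraph \<Rightarrow> bool" where
  "subgraph H G \<longleftrightarrow> simple_graph H \<and> verts H \<subseteq> verts G \<and> edges H \<subseteq> edges G"

definition isomorphic :: "'a ugraph \<Rightarrow> 'b ugraph \<Rightarrow> bool" where
  "isomorphic F H \<longleftrightarrow>
     (\<exists>f. bij_betw f (verts F) (verts H) \<and>
          (\<forall>u\<in>verts F. \<forall>v\<in>verts F. {u, v} \<in> edges F \<longleftrightarrow> {f u, f v} \<in> edges H))"

definition free_of :: "'b ugraph \<Rightarrow> 'a ugraph \<Rightarrow> bool" where
  "free_of F G \<longleftrightarrow> \<not> (\<exists>H. subgraph H G \<and> isomorphic F H)"

(* The cycle C_n; a simple graph, and the intended one, only for n >= 3. *)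
definition cycle_graph :: "nat \<Rightarrow> nat ugraph" where
  "cycle_graph n = \<lparr>verts = {..<n}, edges = {{i, (i + 1) mod n} | i. i < n}\<rparr>"

definition line_graph :: "'a ugraph \<Rightarrow> 'a set ugraph" where
  "line_graph G =
     \<lparr>verts = edges G,
      edges = {{e, f} | e f. e \<in> edges G \<and> f \<in> edges G \<and> e \<noteq> f \<and> e \<inter> f \<noteq> {}}\<rparr>"

definition walk :: "'a ugraph \<Rightarrow> 'a \<Rightarrow> 'a list \<Rightarrow> 'a \<Rightarrow> bool" where
  "walk G u p v \<longleftrightarrow>
     p \<noteq> [] \<and> hd p = u \<and> last p = v \<and> set p \<subseteq> verts G \<and>
     successively (\<lambda>x y. {x, y} \<in> edges G) p"

(* A walk is given by its list of vertices, so its length is one less than that of the list.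
   The distance is \<infinity> (the infimum of the empty set) if there is no walk. *)
definition distance :: "'a ugraph \<Rightarrow> 'a \<Rightarrow> 'a \<Rightarrow> enat" where
  "distance G u v = (INF p \<in> {p. walk G u p v}. enat (length p - 1))"

definition edge_distance :: "'a ugraph \<Rightarrow> 'a set \<Rightarrow> 'a set \<Rightarrow> enat" where
  "edge_distance G e f = distance (line_graph G) e f"

definition strong_clique :: "'a ugraph \<Rightarrow> 'a set set \<Rightarrow> bool" where
  "strong_clique G S \<longleftrightarrow>
     S \<subseteq> edges G \<and> (\<forall>e\<in>S. \<forall>f\<in>S. edge_distance G e f \<le> 2)"

definition strong_clique_number :: "'a ugraph \<Rightarrow> nat" where
  "strong_clique_number G = Max (card ` {S. strong_clique G S})"

end

theory Submission
  imports Defs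
begin

text \<open>
  View the bipartite graph as a relation \<open>E\<close> between the two sides; the strong clique is a
  subrelation \<open>S\<close> such that for any two of its edges \<open>(a, b)\<close>, \<open>(a', b')\<close> one of the cross pairs
  \<open>(a, b')\<close>, \<open>(a', b)\<close> is in \<open>E\<close>. So the edges of a matching in \<open>S\<close> carry a semicomplete digraph, and
  for \<open>k \<ge> 3\<close> such a digraph on \<open>k + 1\<close> vertices yields a \<open>C\<^bsub>2k\<^esub>\<close>. Hence, by Koenig's theorem, \<open>S\<close> has a vertex
  cover \<open>P \<union> Q\<close> of size at most \<open>k\<close>. If \<open>S\<close> has at least \<open>k\<Delta> - (k - 2)\<close> edges, the vertices of \<open>P\<close>,
  and likewise those of \<open>Q\<close>, fall short of \<open>\<Delta>\<close> private \<open>S\<close>-edges by at most \<open>k - 2\<close> in total, and the private neighbourhoods of cover vertices on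
  the same side are pairwise nested up to \<open>E\<close>. So cover vertices, ordered by degree, can be strung together
  greedily through distinct common neighbours, and the two sides are joined through a nonadjacent pair
  of \<open>P \<times> Q\<close>, whose private neighbourhoods are completely joined to each other. The case \<open>\<Delta> < k\<close>
  follows from the bound \<open>\<Delta>\<^sup>2\<close> for bipartite strong cliques, and \<open>k = 2\<close> is treated directly, as \<open>C\<^sub>6\<close> is
  then an exception to the matching bound.
\<close>

definition even_cycle :: "nat \<Rightarrow> ('a \<times> 'b) set \<Rightarrow> bool" where
  "even_cycle k E \<longleftrightarrow>
     (\<exists>x y. inj_on x {..<k} \<and> inj_on y {..<k} \<and>
            (\<forall>i<k. (x i, y i) \<in> E \<and> (x i, y (Suc i mod k)) \<in> E))"

lemma even_cycle_converse:
  assumes "even_cycle k (E\<inverse>)"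
  shows "even_cycle k E"
proof -
  obtain x y where x: "inj_on x {..<k}" and y: "inj_on y {..<k}"
    and xy: "\<And>i. i < k \<Longrightarrow> (y i, x i) \<in> E" "\<And>i. i < k \<Longrightarrow> (y (Suc i mod k), x i) \<in> E"
    using assms by (auto simp: even_cycle_def)
  define z where "z i = x ((i + (k - 1)) mod k)" for i
  have "inj_on (\<lambda>i. (i + (k - 1)) mod k) {..<k}"
  proof (rule inj_onI)
    fix i j assume ij: "i \<in> {..<k}" "j \<in> {..<k}" and eq: "(i + (k - 1)) mod k = (j + (k - 1)) mod k"
    have *: "(i + (k - 1)) mod k = (if i = 0 then k - 1 else i - 1)" if "i < k" for i
      using that by (cases i) auto
    show "i = j" using ij eq unfolding *[of i, OF ij(1)[unfolded lessThan_iff]] *[of j, OF ij(2)[unfolded lessThan_iff]]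
      by (auto split: if_splits)
  qed
  then have "inj_on z {..<k}"
    using comp_inj_on[of "\<lambda>i. (i + (k - 1)) mod k" "{..<k}" x] inj_on_subset[OF x]
    by (simp add: z_def[abs_def] comp_def image_subset_iff)
  moreover have "(y i, z i) \<in> E \<and> (y i, z (Suc i mod k)) \<in> E" if i: "i < k" for i
  proof
    have "(Suc i mod k + (k - 1)) mod k = i"
      using i by (cases "Suc i = k") auto
    then show "(y i, z (Suc i mod k)) \<in> E" using xy(1)[OF i] by (simp add: z_def)
    let ?j = "(i + (k - 1)) mod k"
    have "?j < k" "Suc ?j mod k = i" using i by (auto simp: mod_Suc_eq)
    then show "(y i, z i) \<in> E" using xy(2)[of ?j] by (simp add: z_def)
  qed
  ultimately show ?thesis using y unfolding even_cycle_def by blast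
qed

lemma ex_distinct_representatives:
  assumes "finite I" and "\<And>t. card {i \<in> I. card (M i) \<le> t} \<le> t"
  shows "\<exists>f. inj_on f I \<and> (\<forall>i\<in>I. f i \<in> M i)"
  using assms
proof (induction rule: finite_ranking_induct[where f = "\<lambda>i. card (M i)"])
  case empty
  then show ?case by simp
next
  case (insert j I)
  show ?case
  proof (cases "j \<in> I")
    case True
    then show ?thesis using insert by (simp add: insert_absorb)
  next
    case False
    have "card {i \<in> I. card (M i) \<le> t} \<le> t" for t
    proof -
      have "card {i \<in> I. card (M i) \<le> t} \<le> card {i \<in> insert j I. card (M i) \<le> t}"
        using insert.hyps(1) by (intro card_mono) auto
      then show ?thesis using insert.prems[of t] by linarith
    qed
    then obtain f where f: "inj_on f I" "\<forall>i\<in>I. f i \<in> M i" using insert.IH by blast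
    have "card I < card (M j)"
    proof (rule ccontr)
      assume "\<not> card I < card (M j)"
      then have "{i \<in> insert j I. card (M i) \<le> card I} = insert j I"
        using insert.hyps(2) by force
      then show False using insert.prems[of "card I"] False insert.hyps(1) by simp
    qed
    then have "\<not> M j \<subseteq> f ` I"
      using card_image_le[OF insert.hyps(1), of f] card_mono[of "f ` I" "M j"] insert.hyps(1) by force
    then obtain y where "y \<in> M j" "y \<notin> f ` I" by blast
    then have "inj_on (f(j := y)) (insert j I)" "\<forall>i\<in>insert j I. (f(j := y)) i \<in> M i"
      using f False by (auto simp: inj_on_def)
    then show ?thesis by blast
  qed
qed

text \<open>
  The vertices of \<open>P - {z}\<close> are listed by increasing degree \<open>d\<close>, followed by \<open>z\<close>. The assumptions say
  that there are few vertices of small degree, which is what the greedy choice of the \<open>y i\<close> needs;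
  \<open>r\<close> is the number of additional neighbours wanted for \<open>z\<close>.
\<close>

lemma ex_chain:
  fixes d :: "'a \<Rightarrow> nat" and M :: "'a \<Rightarrow> 'b set"
  assumes "finite P" "z \<in> P"
    and common: "\<And>a b. a \<in> P \<Longrightarrow> b \<in> P \<Longrightarrow> min (d a) (d b) \<le> card (M a \<inter> M b)"
    and small: "\<And>t. t < card P + r \<Longrightarrow> t < d z \<Longrightarrow> {c \<in> P. d c \<le> t} \<noteq> {} \<Longrightarrow>
                  card {c \<in> P. d c \<le> t} < t"
    and large: "\<And>t. t < card P + r \<Longrightarrow> d z \<le> t \<Longrightarrow> card {c \<in> P. d c \<le> t} + 1 + r \<le> t"
  obtains c y where "bij_betw c {..<card P} P" "c (card P - 1) = z" "inj_on y {..<card P + r}"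
    "y 0 \<in> M (c 0)" "y 0 \<in> M z"
    "\<And>i. 0 < i \<Longrightarrow> i < card P \<Longrightarrow> y i \<in> M (c (i - 1)) \<inter> M (c i)"
    "\<And>i. card P \<le> i \<Longrightarrow> i < card P + r \<Longrightarrow> y i \<in> M z"
proof -
  obtain ws where ws: "set ws = P - {z}" "distinct ws"
    using finite_distinct_list[of "P - {z}"] \<open>finite P\<close> by auto
  define xs where "xs = sort_key d ws"
  have xs: "set xs = P - {z}" "distinct xs" "sorted (map d xs)"
    using ws by (auto simp: xs_def)
  define p where "p = card P"
  have p: "p = Suc (length xs)"
    using distinct_card[OF xs(2)] card_Suc_Diff1[OF \<open>finite P\<close> \<open>z \<in> P\<close>] by (simp add: p_def xs(1))
  define c where "c i = (xs @ [z]) ! i" for i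
  have c_bij: "bij_betw c {..<p} P"
  proof -
    have "bij_betw ((!) (xs @ [z])) {..<length (xs @ [z])} (set (xs @ [z]))"
      using xs by (intro bij_betw_nth) auto
    moreover have "set (xs @ [z]) = P" using xs \<open>z \<in> P\<close> by auto
    ultimately show ?thesis using p unfolding c_def by (simp add: lessThan_Suc)
  qed
  have c_last: "c (p - 1) = z" by (simp add: c_def p)
  have cP: "c i \<in> P" if "i < p" for i using c_bij that by (auto simp: bij_betw_def)
  have cz: "c i \<noteq> z" if "i < p - 1" for i
    using that nth_mem[of i xs] xs(1) by (auto simp: c_def p nth_append)
  have mono: "d (c i) \<le> d (c j)" if "i \<le> j" "j < p - 1" for i j
    using that sorted_nth_mono[OF xs(3), of i j] by (auto simp: c_def p nth_append)
  define N where "N i = (if i = 0 then M (c 0) \<inter> M z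
                         else if i < p then M (c (i - 1)) \<inter> M (c i) else M z)" for i
  have N0: "min (d (c 0)) (d z) \<le> card (N 0)"
    using common[of "c 0" z] cP[of 0] p \<open>z \<in> P\<close> by (simp add: N_def)
  have Nmid: "d (c (i - 1)) \<le> card (N i)" if "0 < i" "i < p - 1" for i
    using common[of "c (i - 1)" "c i"] cP[of i] cP[of "i - 1"] that mono[of "i - 1" i] p
    by (auto simp: N_def)
  have Nlast: "min (d (c (p - 2))) (d z) \<le> card (N (p - 1))" if "1 < p"
    using common[of "c (p - 2)" "c (p - 1)"] cP[of "p - 2"] cP[of "p - 1"] that c_last
    by (simp add: N_def numeral_2_eq_2)
  have Nz: "d z \<le> card (N i)" if "p \<le> i" for i
    using that p common[of z z] \<open>z \<in> P\<close> by (simp add: N_def)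
  have "card {i \<in> {..<p + r}. card (N i) \<le> t} \<le> t" (is "card ?B \<le> t") for t
  proof (cases "t < p + r")
    case False
    have "card ?B \<le> card {..<p + r}" by (rule card_mono) auto
    then show ?thesis using False by simp
  next
    case True
    let ?C = "{a \<in> P. d a \<le> t}"
    show ?thesis
    proof (cases "t < d z")
      case tz: True
      have sub: "?B \<subseteq> insert 0 {i \<in> {0<..<p}. d (c (i - 1)) \<le> t}" (is "_ \<subseteq> insert 0 ?J")
      proof
        fix i assume i: "i \<in> ?B"
        then have "i < p" using Nz[of i] tz by (cases "p \<le> i") auto
        moreover have "d (c (i - 1)) \<le> t" if "0 < i"
        proof (cases "i < p - 1")
          case True
          then show ?thesis using Nmid[of i] that i by auto
        next
          case False
          then have "i = p - 1" "1 < p" using \<open>i < p\<close> that by auto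
          then show ?thesis using Nlast i tz by (auto simp: numeral_2_eq_2)
        qed
        ultimately show "i \<in> insert 0 ?J" by auto
      qed
      have "inj_on (\<lambda>i. c (i - 1)) ?J"
      proof (rule inj_onI)
        fix i j assume "i \<in> ?J" "j \<in> ?J" "c (i - 1) = c (j - 1)"
        then have "i - 1 = j - 1" using c_bij by (auto simp: bij_betw_def inj_on_def)
        then show "i = j" using \<open>i \<in> ?J\<close> \<open>j \<in> ?J\<close> by auto
      qed
      moreover have "(\<lambda>i. c (i - 1)) ` ?J \<subseteq> ?C" using cP by auto
      ultimately have J: "card ?J \<le> card ?C" using \<open>finite P\<close> by (intro card_inj_on_le) auto
      have B: "card ?B \<le> Suc (card ?J)"
        using card_mono[OF _ sub] card_insert_le_m1 by (simp add: card_insert_if split: if_splits)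
      show ?thesis
      proof (cases "?C = {}")
        case True
        then have "?J = {}" using cP by auto
        moreover have "0 \<notin> ?B" using True N0 tz cP[of 0] p by (auto simp: min_def split: if_splits)
        ultimately have "?B = {}" using sub by auto
        then show ?thesis by (simp only: card.empty)
      next
        case False
        then show ?thesis using small[of t] True tz J B by (simp add: p_def)
      qed
    next
      case False
      let ?J = "{i \<in> {0<..<p - 1}. d (c (i - 1)) \<le> t}"
      have sub: "?B \<subseteq> {0, p - 1} \<union> ?J \<union> {p..<p + r}"
      proof
        fix i assume i: "i \<in> ?B"
        have "i = 0 \<or> 0 < i \<and> i < p - 1 \<or> i = p - 1 \<or> p \<le> i" by linarith
        then show "i \<in> {0, p - 1} \<union> ?J \<union> {p..<p + r}" using i Nmid[of i] by auto
      qed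
      have "inj_on (\<lambda>i. c (i - 1)) ?J"
      proof (rule inj_onI)
        fix i j assume "i \<in> ?J" "j \<in> ?J" "c (i - 1) = c (j - 1)"
        then have "i - 1 = j - 1" using c_bij by (auto simp: bij_betw_def inj_on_def)
        then show "i = j" using \<open>i \<in> ?J\<close> \<open>j \<in> ?J\<close> by auto
      qed
      moreover have "(\<lambda>i. c (i - 1)) ` ?J \<subseteq> ?C - {z}"
      proof
        fix a assume "a \<in> (\<lambda>i. c (i - 1)) ` ?J"
        then obtain i where "a = c (i - 1)" "i - 1 < p - 1" "d (c (i - 1)) \<le> t" by auto
        then show "a \<in> ?C - {z}" using cP[of "i - 1"] cz[of "i - 1"] by auto
      qed
      ultimately have "card ?J \<le> card (?C - {z})" using \<open>finite P\<close> by (intro card_inj_on_le) auto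
      then have J: "Suc (card ?J) \<le> card ?C"
        using False \<open>z \<in> P\<close> \<open>finite P\<close> card_Suc_Diff1[of ?C z] by simp
      have "card ?B \<le> card ({0, p - 1} \<union> ?J \<union> {p..<p + r})"
        by (rule card_mono[OF _ sub]) auto
      also have "\<dots> \<le> card {0, p - 1} + card ?J + r"
        by (metis (no_types, lifting) add_diff_cancel_left' add_le_mono1 card_Un_le card_atLeastLessThan le_trans)
      also have "\<dots> \<le> 2 + card ?J + r" by (simp add: card_insert_if)
      also have "\<dots> \<le> t" using J large[of t] True False by (simp add: p_def)
      finally show ?thesis .
    qed
  qed
  then obtain y where y: "inj_on y {..<p + r}" "\<forall>i\<in>{..<p + r}. y i \<in> N i"
    using ex_distinct_representatives[of "{..<p + r}" N] by blast
  show ?thesis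
  proof (rule that[of c y])
    show "y i \<in> M (c (i - 1)) \<inter> M (c i)" if "0 < i" "i < card P" for i
      using bspec[OF y(2), of i] that by (auto simp: N_def p_def)
    show "y i \<in> M z" if "card P \<le> i" "i < card P + r" for i
      using bspec[OF y(2), of i] that p by (auto simp: N_def p_def)
  qed (use bspec[OF y(2), of 0] y(1) c_bij c_last p in \<open>auto simp: N_def p_def\<close>)
qed

definition matching :: "('a \<times> 'b) set \<Rightarrow> bool" where
  "matching M \<longleftrightarrow> (\<forall>(a, b)\<in>M. \<forall>(a', b')\<in>M. a = a' \<longleftrightarrow> b = b')"

definition covers :: "('a \<times> 'b) set \<Rightarrow> 'a set \<Rightarrow> 'b set \<Rightarrow> bool" where
  "covers S P Q \<longleftrightarrow> finite P \<and> finite Q \<and> (\<forall>(a, b)\<in>S. a \<in> P \<or> b \<in> Q)"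

lemma covers_converse: "covers (S\<inverse>) Q P \<longleftrightarrow> covers S P Q"
  by (auto simp: covers_def)

text \<open>Submodularity: the join and the meet of two covers together are only one vertex larger.\<close>

lemma covers_merge:
  assumes "covers (S - {(x, y)}) P1 Q1" "covers (S - {(x, z)}) P2 Q2" "y \<noteq> z"
    and "(x, y) \<in> S" "(x, z) \<in> S"
    and m: "card P1 + card Q1 \<le> m" "card P2 + card Q2 \<le> m"
  shows "\<exists>P Q. covers S P Q \<and> card P + card Q \<le> m"
proof (cases "covers S P1 Q1 \<or> covers S P2 Q2")
  case True
  then show ?thesis using m by blast
next
  case False
  have fin: "finite P1" "finite Q1" "finite P2" "finite Q2" using assms by (auto simp: covers_def)
  have c1: "a \<in> P1 \<or> b \<in> Q1" if "(a, b) \<in> S" "(a, b) \<noteq> (x, y)" for a b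
    using assms(1) that unfolding covers_def by blast
  have c2: "a \<in> P2 \<or> b \<in> Q2" if "(a, b) \<in> S" "(a, b) \<noteq> (x, z)" for a b
    using assms(2) that unfolding covers_def by blast
  have "x \<notin> P1"
  proof
    assume "x \<in> P1"
    then have "covers S P1 Q1" using c1 fin unfolding covers_def by blast
    then show False using False by blast
  qed
  then have "z \<in> Q1" using c1[of x z] assms(3,5) by auto
  have "x \<notin> P2"
  proof
    assume "x \<in> P2"
    then have "covers S P2 Q2" using c2 fin unfolding covers_def by blast
    then show False using False by blast
  qed
  then have "y \<in> Q2" using c2[of x y] assms(3,4) by auto
  have "covers S (insert x (P1 \<union> P2)) (Q1 \<inter> Q2)"
    using c1 c2 fin unfolding covers_def by blast
  moreover have "covers S (P1 \<inter> P2) (Q1 \<union> Q2)"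
    using c1 c2 fin \<open>z \<in> Q1\<close> \<open>y \<in> Q2\<close> unfolding covers_def by blast
  moreover have "card (insert x (P1 \<union> P2)) + card (Q1 \<inter> Q2) \<le> m \<or> card (P1 \<inter> P2) + card (Q1 \<union> Q2) \<le> m"
    using m card_Un_Int[of P1 P2] card_Un_Int[of Q1 Q2] fin card_insert_le_m1[of "Suc (card (P1 \<union> P2))" "P1 \<union> P2" x]
    by simp linarith
  ultimately show ?thesis by blast
qed

theorem koenig:
  assumes "finite S"
  shows "\<exists>M P Q. M \<subseteq> S \<and> matching M \<and> covers S P Q \<and> card P + card Q \<le> card M"
  using assms
proof (induction rule: finite_psubset_induct)
  case (psubset S)
  have IH: "\<exists>M P Q. M \<subseteq> S \<and> matching M \<and> covers (S - {e}) P Q \<and> card P + card Q \<le> card M"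
    if "e \<in> S" for e
    using psubset.IH[of "S - {e}"] that by blast
  have merge: "\<exists>M P1 Q1 P2 Q2. M \<subseteq> S \<and> matching M \<and> covers (S - {e}) P1 Q1 \<and> covers (S - {f}) P2 Q2
      \<and> card P1 + card Q1 \<le> card M \<and> card P2 + card Q2 \<le> card M" if ef: "e \<in> S" "f \<in> S" for e f
  proof -
    obtain M1 P1 Q1 where 1: "M1 \<subseteq> S" "matching M1" "covers (S - {e}) P1 Q1" "card P1 + card Q1 \<le> card M1"
      using IH[OF ef(1)] by blast
    obtain M2 P2 Q2 where 2: "M2 \<subseteq> S" "matching M2" "covers (S - {f}) P2 Q2" "card P2 + card Q2 \<le> card M2"
      using IH[OF ef(2)] by blast
    show ?thesis
    proof (cases "card M1 \<le> card M2")
      case True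
      then show ?thesis using 1 2 by (meson le_trans)
    next
      case False
      then show ?thesis using 1 2 by (meson le_trans nat_le_linear)
    qed
  qed
  consider "matching S" | x y z where "(x, y) \<in> S" "(x, z) \<in> S" "y \<noteq> z"
    | x y z where "(y, x) \<in> S" "(z, x) \<in> S" "y \<noteq> z"
    by (fastforce simp: matching_def)
  then show ?case
  proof cases
    case 1
    have "covers S (fst ` S) {}" "card (fst ` S) + card {} \<le> card S"
      using psubset.hyps by (force simp: covers_def) (simp add: psubset.hyps card_image_le)
    then show ?thesis using 1 by blast
  next
    case 2
    then show ?thesis using merge[OF 2(1,2)] covers_merge[of S x y _ _ z] by meson
  next
    case 3
    obtain M P1 Q1 P2 Q2 where *: "M \<subseteq> S" "matching M" "covers (S - {(y, x)}) P1 Q1"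
      "covers (S - {(z, x)}) P2 Q2" "card P1 + card Q1 \<le> card M" "card P2 + card Q2 \<le> card M"
      using merge[OF 3(1,2)] by blast
    have "S\<inverse> - {(x, y)} = (S - {(y, x)})\<inverse>" "S\<inverse> - {(x, z)} = (S - {(z, x)})\<inverse>" by auto
    then have "\<exists>Q P. covers (S\<inverse>) Q P \<and> card Q + card P \<le> card M"
      using * 3 covers_merge[of "S\<inverse>" x y Q1 P1 z Q2 P2 "card M"]
      by (auto simp: covers_converse add.commute)
    then show ?thesis using * by (metis covers_converse add.commute)
  qed
qed

section \<open>Strong cliques in bipartite relations\<close>

locale strong_clique_rel =
  fixes E S :: "('a \<times> 'b) set" and D :: nat
  assumes finE: "finite E" and S_sub: "S \<subseteq> E"
    and strong: "(a, b) \<in> S \<Longrightarrow> (a', b') \<in> S \<Longrightarrow> (a, b') \<in> E \<or> (a', b) \<in> E"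
    and deg_left: "card (E `` {a}) \<le> D"
    and deg_right: "card (E\<inverse> `` {b}) \<le> D"

lemma strong_clique_rel_converse:
  assumes "strong_clique_rel E S D"
  shows "strong_clique_rel (E\<inverse>) (S\<inverse>) D"
proof -
  interpret strong_clique_rel E S D by fact
  show ?thesis
    by unfold_locales (use finE S_sub strong deg_left deg_right in auto)
qed

context strong_clique_rel
begin

lemma finS: "finite S"
  using finE S_sub finite_subset by blast

lemma finite_nbrs [simp, intro]:
  "finite (E `` {a})" "finite (E\<inverse> `` {b})" "finite (S `` {a})" "finite (S\<inverse> `` {b})"
  using finE finS by (auto intro: finite_Image)

lemma S_left_sub: "S `` {a} \<subseteq> E `` {a}" and S_right_sub: "S\<inverse> `` {b} \<subseteq> E\<inverse> `` {b}"
  using S_sub by auto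

lemma degS_left: "card (S `` {a}) \<le> D" and degS_right: "card (S\<inverse> `` {b}) \<le> D"
  using card_mono[OF _ S_left_sub] card_mono[OF _ S_right_sub] deg_left deg_right
  by (meson finite_nbrs le_trans)+

lemma card_le_square_aux:
  assumes max: "\<And>y. card (S\<inverse> `` {y}) \<le> card (S `` {v})" and ne: "S `` {v} \<noteq> {}"
  shows "card S \<le> D * D"
proof -
  let ?Y = "E `` {v}"
  define d where "d = card (S `` {v})"
  define X where "X = {x. S `` {v} \<subseteq> E `` {x}}"
  obtain u where u: "u \<in> S `` {v}" using ne by blast
  have X: "X \<subseteq> E\<inverse> `` {u}" using u by (auto simp: X_def)
  have finX: "finite X" using finite_subset[OF X] by simp
  have cX: "card X \<le> D" using card_mono[OF _ X] deg_right[of u] by simp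
  have "d \<le> D" using degS_left by (simp add: d_def)
  have "S \<subseteq> (SIGMA y:?Y. S\<inverse> `` {y})\<inverse> \<union> (SIGMA x:X. S `` {x} - ?Y)"
  proof (rule subrelI)
    fix x y assume xy: "(x, y) \<in> S"
    have "x \<in> X" if "y \<notin> ?Y"
      using that strong[OF xy] by (auto simp: X_def)
    then show "(x, y) \<in> (SIGMA y:?Y. S\<inverse> `` {y})\<inverse> \<union> (SIGMA x:X. S `` {x} - ?Y)"
      using xy by auto
  qed
  then have "card S \<le> card ((SIGMA y:?Y. S\<inverse> `` {y})\<inverse> \<union> (SIGMA x:X. S `` {x} - ?Y))"
    using finX by (intro card_mono) auto
  also have "\<dots> \<le> card (SIGMA y:?Y. S\<inverse> `` {y}) + card (SIGMA x:X. S `` {x} - ?Y)"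
    using card_Un_le by (metis card_inverse)
  also have "\<dots> = (\<Sum>y\<in>?Y. card (S\<inverse> `` {y})) + (\<Sum>x\<in>X. card (S `` {x} - ?Y))"
    using finX by (simp add: card_SigmaI)
  also have "(\<Sum>y\<in>?Y. card (S\<inverse> `` {y})) \<le> card ?Y * d"
    using max sum_bounded_above[of ?Y "\<lambda>y. card (S\<inverse> `` {y})" d] by (simp add: d_def)
  also have "card ?Y * d \<le> D * d"
    using deg_left by simp
  also have "(\<Sum>x\<in>X. card (S `` {x} - ?Y)) \<le> card X * (D - d)"
  proof -
    have "card (S `` {x} - ?Y) \<le> D - d" if "x \<in> X" for x
    proof -
      have "card (S `` {x} - ?Y) \<le> card (E `` {x} - S `` {v})"
        using S_sub by (intro card_mono) auto
      also have "\<dots> = card (E `` {x}) - d"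
        using that unfolding d_def by (intro card_Diff_subset) (auto simp: X_def)
      finally show ?thesis using deg_left[of x] by linarith
    qed
    then show ?thesis using sum_bounded_above[of X "\<lambda>x. card (S `` {x} - ?Y)" "D - d"] by simp
  qed
  also have "card X * (D - d) \<le> D * (D - d)" using cX by simp
  also have "D * d + D * (D - d) = D * D"
    using \<open>d \<le> D\<close> by (simp flip: distrib_left)
  finally show ?thesis by simp
qed

end

lemma (in strong_clique_rel) card_le_square: "card S \<le> D * D"
proof (cases "S = {}")
  case True
  then show ?thesis by simp
next
  case False
  interpret conv: strong_clique_rel "E\<inverse>" "S\<inverse>" D
    by (rule strong_clique_rel_converse) unfold_locales
  define degs where "degs = (\<lambda>x. card (S `` {x})) ` fst ` S \<union> (\<lambda>y. card (S\<inverse> `` {y})) ` snd ` S"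
  have fin: "finite degs" using finS by (simp add: degs_def)
  have "degs \<noteq> {}" using False by (simp add: degs_def)
  then have "Max degs \<in> degs" using fin by simp
  have left: "card (S `` {x}) \<le> Max degs" for x
  proof (cases "S `` {x} = {}")
    case False
    then have "card (S `` {x}) \<in> degs" by (force simp: degs_def)
    then show ?thesis using fin by simp
  qed simp
  have right: "card (S\<inverse> `` {y}) \<le> Max degs" for y
  proof (cases "S\<inverse> `` {y} = {}")
    case False
    then have "card (S\<inverse> `` {y}) \<in> degs" by (force simp: degs_def)
    then show ?thesis using fin by simp
  qed simp
  consider v w where "(v, w) \<in> S" "Max degs = card (S `` {v})"
    | v w where "(v, w) \<in> S" "Max degs = card (S\<inverse> `` {w})"
    using \<open>Max degs \<in> degs\<close> by (auto simp: degs_def)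
  then show ?thesis
  proof cases
    case 1
    then show ?thesis using right by (intro card_le_square_aux[of v]) auto
  next
    case 2
    then have "card (S\<inverse>) \<le> D * D" using left by (intro conv.card_le_square_aux[of w]) auto
    then show ?thesis by simp
  qed
qed

lemma ex_insertion_point:
  assumes "us \<noteq> []" "r (hd us) x" "\<And>y. y \<in> set us \<Longrightarrow> r x y \<or> r y x"
  shows "\<exists>ps qs. us = ps @ qs \<and> ps \<noteq> [] \<and> r (last ps) x \<and> (qs = [] \<or> r x (hd qs))"
  using assms
proof (induction us)
  case Nil
  then show ?case by simp
next
  case (Cons a us)
  show ?case
  proof (cases "us = [] \<or> r x (hd us)")
    case True
    then show ?thesis using Cons.prems by (intro exI[of _ "[a]"] exI[of _ us]) auto
  next
    case False
    then have "r (hd us) x" using Cons.prems(3)[of "hd us"] by auto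
    then obtain ps qs where "us = ps @ qs" "ps \<noteq> []" "r (last ps) x" "qs = [] \<or> r x (hd qs)"
      using Cons.IH Cons.prems False by auto
    then show ?thesis by (intro exI[of _ "a # ps"] exI[of _ qs]) auto
  qed
qed

lemma ex_hamiltonian_path:
  assumes "finite V" "\<And>x y. x \<in> V \<Longrightarrow> y \<in> V \<Longrightarrow> r x y \<or> r y x"
  shows "\<exists>us. distinct us \<and> set us = V \<and> successively r us"
  using assms
proof (induction V)
  case empty
  then show ?case by simp
next
  case (insert x V)
  then obtain us where us: "distinct us" "set us = V" "successively r us" by auto
  show ?case
  proof (cases "us \<noteq> [] \<and> r (hd us) x")
    case True
    then obtain ps qs where "us = ps @ qs" "ps \<noteq> []" "r (last ps) x" "qs = [] \<or> r x (hd qs)"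
      using ex_insertion_point[of us r x] insert.prems us(2) by auto
    then show ?thesis using us insert.hyps
      by (intro exI[of _ "ps @ x # qs"]) (auto simp: successively_append_iff successively_Cons)
  next
    case False
    then have "us = [] \<or> r x (hd us)" using insert.prems[of x "hd us"] us(2) hd_in_set[of us] by auto
    then show ?thesis using us insert.hyps
      by (intro exI[of _ "x # us"]) (auto simp: successively_Cons)
  qed
qed

text \<open>The cyclic triangle shows that \<open>3 \<le> k\<close> cannot be weakened.\<close>

lemma semicomplete_cycle_or_closed_path:
  assumes "finite V" "card V = Suc k" "3 \<le> k"
    and total: "\<And>x y. x \<in> V \<Longrightarrow> y \<in> V \<Longrightarrow> r x y \<or> r y x"
  shows "\<exists>us. distinct us \<and> set us \<subseteq> V \<and> successively r us \<and>
              (length us = k \<and> r (last us) (hd us) \<or> length us = Suc k \<and> r (hd us) (last us))"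
    (is "\<exists>us. ?Q us")
proof -
  obtain x where x: "x \<in> V" using assms by fastforce
  obtain us where us: "distinct us" "set us = V - {x}" "successively r us"
    using ex_hamiltonian_path[of "V - {x}" r] assms by auto
  have len: "length us = k" using us assms(1,2) x by (metis card_Diff_singleton diff_Suc_1 distinct_card)
  obtain p vs where p: "us = p # vs" using len \<open>3 \<le> k\<close> by (cases us) auto
  obtain ws l where l: "vs = ws @ [l]" using len \<open>3 \<le> k\<close> p by (cases vs rule: rev_cases) auto
  have us_eq: "us = p # ws @ [l]" "ws \<noteq> []" using len \<open>3 \<le> k\<close> p l by auto
  have in_V: "p \<in> V" "l \<in> V" "set ws \<subseteq> V" "x \<notin> set us" "p \<noteq> x" "l \<noteq> x"
    using us us_eq by auto
  have w: "r p (hd ws)" "successively r ws" "r (last ws) l" "distinct ws" "p \<notin> set ws" "l \<notin> set ws" "p \<noteq> l"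
      "x \<notin> set ws" "length ws + 2 = k"
    using us us_eq len by (auto simp: successively_Cons successively_append_iff)
  have tx: "r x y \<or> r y x" if "y \<in> set us" for y using total us(2) x that by blast
  show ?thesis
  proof (cases "r l p")
    case True
    then have "?Q us" using us len us_eq by auto
    then show ?thesis by blast
  next
    case False
    then have pl: "r p l" using total in_V by blast
    show ?thesis
    proof (cases "r p x")
      case True
      then obtain ps qs where s: "us = ps @ qs" "ps \<noteq> []" "r (last ps) x" "qs = [] \<or> r x (hd qs)"
        using ex_insertion_point[of us r x] tx us_eq by auto
      have "hd ps = p"
        using arg_cong[OF s(1), of hd] s(2) us_eq by simp
      moreover have "last qs = l" if "qs \<noteq> []"
        using arg_cong[OF s(1), of last] that us_eq by simp
      ultimately have "?Q (ps @ x # qs)"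
        using s us len pl True x by (auto simp: successively_append_iff successively_Cons)
      then show ?thesis by blast
    next
      case npx: False
      then have xp: "r x p" using total in_V x by blast
      show ?thesis
      proof (cases "r x l")
        case True
        then have "?Q (x # us)" using us len us_eq xp x by (auto simp: successively_Cons)
        then show ?thesis by blast
      next
        case False
        then have lx: "r l x" using total in_V x by blast
        show ?thesis
        proof (cases "r x (hd ws)")
          case True
          then have "?Q (x # ws @ [l])"
            using w in_V us_eq x lx by (auto simp: successively_append_iff successively_Cons)
          then show ?thesis by blast
        next
          case False
          then have "r (hd ws) x" using total in_V us_eq x by (metis hd_in_set subsetD)
          then obtain ps qs where s: "ws = ps @ qs" "ps \<noteq> []" "r (last ps) x" "qs = [] \<or> r x (hd qs)"
            using ex_insertion_point[of ws r x] tx us_eq by auto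
          show ?thesis
          proof (cases "qs = []")
            case True
            then have "?Q (x # p # ws)"
              using s w in_V us_eq x xp by (auto simp: successively_Cons)
            then show ?thesis by blast
          next
            case False
            then have "?Q (p # ps @ x # qs @ [l])"
              using s w in_V us_eq x pl by (auto simp: successively_append_iff successively_Cons)
            then show ?thesis by blast
          qed
        qed
      qed
    qed
  qed
qed

lemma (in strong_clique_rel) matching_imp_even_cycle:
  assumes "M \<subseteq> S" "matching M" "card M = Suc k" "3 \<le> k"
  shows "even_cycle k E"
proof -
  define r :: "'a \<times> 'b \<Rightarrow> 'a \<times> 'b \<Rightarrow> bool"
    where "r e f \<longleftrightarrow> (fst e, snd f) \<in> E" for e f
  have "finite M" using assms(1) finS finite_subset by blast
  moreover have "r e f \<or> r f e" if "e \<in> M" "f \<in> M" for e f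
    using strong[of "fst e" "snd e" "fst f" "snd f"] that assms(1) by (auto simp: r_def)
  ultimately obtain us where us: "distinct us" "set us \<subseteq> M" "successively r us"
    "length us = k \<and> r (last us) (hd us) \<or> length us = Suc k \<and> r (hd us) (last us)"
    using semicomplete_cycle_or_closed_path[of M k r] assms by blast
  have step: "r (us ! i) (us ! Suc i)" if "Suc i < length us" for i
    using us(3) that by (simp add: successively_conv_nth)
  have mem: "us ! i \<in> M" if "i < length us" for i using us(2) that by auto
  have loop: "r (us ! i) (us ! i)" if "i < length us" for i
    using mem[OF that] assms(1) S_sub by (auto simp: r_def)
  have inj: "i = j" if "i < length us" "j < length us"
    "fst (us ! i) = fst (us ! j) \<or> snd (us ! i) = snd (us ! j)" for i j
  proof -
    have "us ! i = us ! j"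
      using assms(2) mem[OF that(1)] mem[OF that(2)] that(3) unfolding matching_def
      by (cases "us ! i"; cases "us ! j") fastforce
    then show ?thesis using us(1) that by (simp add: nth_eq_iff_index_eq)
  qed
  show ?thesis
  proof (cases "length us = k")
    case True
    then have closed: "r (us ! (k - 1)) (us ! 0)"
      using us(4) assms(4) last_conv_nth[of us] hd_conv_nth[of us] by fastforce
    have "inj_on (\<lambda>i. fst (us ! i)) {..<k}" "inj_on (\<lambda>i. snd (us ! i)) {..<k}"
      using inj True by (auto intro!: inj_onI)
    moreover have "(fst (us ! i), snd (us ! i)) \<in> E \<and> (fst (us ! i), snd (us ! (Suc i mod k))) \<in> E"
      if "i < k" for i
    proof (cases "Suc i = k")
      case True
      then have "i = k - 1" by simp
      then show ?thesis using loop[of i] closed that \<open>length us = k\<close> True by (simp add: r_def)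
    next
      case False
      then show ?thesis using loop[of i] step[of i] that \<open>length us = k\<close> by (simp add: r_def)
    qed
    ultimately show ?thesis unfolding even_cycle_def by blast
  next
    case False
    then have len: "length us = Suc k" and closed: "r (us ! 0) (us ! k)"
      using us(4) assms(4) last_conv_nth[of us] hd_conv_nth[of us] by fastforce+
    define y where "y i = snd (us ! (if i = 0 then k else i))" for i
    have "inj_on (\<lambda>i. fst (us ! i)) {..<k}"
      using inj len by (auto intro!: inj_onI)
    moreover have "inj_on y {..<k}"
    proof (rule inj_onI)
      fix i j assume "i \<in> {..<k}" "j \<in> {..<k}" "y i = y j"
      then show "i = j"
        using inj[of "if i = 0 then k else i" "if j = 0 then k else j"] len
        by (auto simp: y_def split: if_splits)
    qed
    moreover have "(fst (us ! i), y i) \<in> E \<and> (fst (us ! i), y (Suc i mod k)) \<in> E"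
      if "i < k" for i
      using loop[of i] step[of i] closed that len
      by (cases "Suc i = k") (auto simp: r_def y_def)
    ultimately show ?thesis unfolding even_cycle_def by blast
  qed
qed

lemma even_cycle_2I:
  assumes "(a, b) \<in> E" "(a, b') \<in> E" "(a', b) \<in> E" "(a', b') \<in> E" "a \<noteq> a'" "b \<noteq> b'"
  shows "even_cycle 2 E"
proof -
  have "inj_on (\<lambda>i::nat. if i = 0 then a else a') {..<2}" "inj_on (\<lambda>i::nat. if i = 0 then b else b') {..<2}"
    using assms by (auto simp: inj_on_def)
  moreover have "((if i = 0 then a else a'), (if i = 0 then b else b')) \<in> E \<and>
      ((if i = 0 then a else a'), (if Suc i mod 2 = 0 then b else b')) \<in> E" if "i < 2" for i :: nat
    using that assms by (auto simp: less_2_cases_iff)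
  ultimately show ?thesis unfolding even_cycle_def by blast
qed

lemma (in strong_clique_rel) no_even_cycle_2_star:
  assumes no: "\<not> even_cycle 2 E" and "(v, b1) \<in> S" "(v, b2) \<in> S" "b1 \<noteq> b2"
  shows "card S + 1 \<le> 2 * D"
proof -
  have C4: False if "(a, b) \<in> E" "(a, b') \<in> E" "(a', b) \<in> E" "(a', b') \<in> E" "a \<noteq> a'" "b \<noteq> b'" for a b a' b'
    using even_cycle_2I that no by metis
  have E: "(a, b) \<in> E" if "(a, b) \<in> S" for a b using S_sub that by blast
  have N: "(v, y) \<in> E" if "(x, y) \<in> S" for x y
    using C4[of v b1 b2 x] strong[OF assms(2) that] strong[OF assms(3) that] E assms that by metis
  have one: "y = y'" if "(x, y) \<in> S" "(x', y') \<in> S" "x \<noteq> v" "x' \<noteq> v" for x y x' y'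
    using strong[OF that(1,2)] C4[of x y y' v] C4[of x' y y' v] N E that by metis
  show ?thesis
  proof (cases "\<exists>x y. (x, y) \<in> S \<and> x \<noteq> v")
    case False
    then have "S \<subseteq> {v} \<times> S `` {v}" by auto
    then have "card S \<le> card ({v} \<times> S `` {v})" by (intro card_mono) auto
    then have "card S \<le> card (S `` {v})" by (simp add: card_cartesian_product)
    moreover have "1 \<le> card (S `` {v})"
      using assms(2) card_gt_0_iff[of "S `` {v}"] by auto
    ultimately show ?thesis using degS_left[of v] by linarith
  next
    case True
    then obtain x y where xy: "(x, y) \<in> S" "x \<noteq> v" by blast
    have "S \<subseteq> {v} \<times> S `` {v} \<union> (E\<inverse> `` {y} - {v}) \<times> {y}"
    proof (rule subrelI)
      fix x' y' assume xy': "(x', y') \<in> S"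
      then have "y' = y" if "x' \<noteq> v" using one[OF xy' xy(1)] that xy(2) by blast
      then show "(x', y') \<in> {v} \<times> S `` {v} \<union> (E\<inverse> `` {y} - {v}) \<times> {y}"
        using E[OF xy'] xy' by auto
    qed
    then have "card S \<le> card ({v} \<times> S `` {v} \<union> (E\<inverse> `` {y} - {v}) \<times> {y})"
      by (intro card_mono) auto
    also have "\<dots> \<le> card ({v} \<times> S `` {v}) + card ((E\<inverse> `` {y} - {v}) \<times> {y})"
      by (rule card_Un_le)
    also have "\<dots> = card (S `` {v}) + (card (E\<inverse> `` {y}) - 1)"
      using N[OF xy(1)] by (simp add: card_cartesian_product)
    finally have "card S \<le> card (S `` {v}) + (card (E\<inverse> `` {y}) - 1)" .
    moreover have "1 \<le> card (E\<inverse> `` {y})"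
      using N[OF xy(1)] card_gt_0_iff[of "E\<inverse> `` {y}"] by auto
    ultimately show ?thesis using degS_left[of v] deg_right[of y] by linarith
  qed
qed

lemma (in strong_clique_rel) no_even_cycle_2_matching:
  assumes no: "\<not> even_cycle 2 E" and "matching S"
  shows "card S \<le> 3"
proof (rule ccontr)
  assume "\<not> card S \<le> 3"
  then obtain M where M: "M \<subseteq> S" "card M = 4" "finite M"
    using obtain_subset_with_card_n[of 4 S] by auto
  obtain es where es: "set es = M" "distinct es" using finite_distinct_list[OF M(3)] by blast
  then have "length es = 4" using M distinct_card by metis
  then obtain e1 e2 e3 e4 where "es = [e1, e2, e3, e4]"
    by (auto simp: length_Suc_conv numeral_eq_Suc)
  then have e: "e1 \<in> S" "e2 \<in> S" "e3 \<in> S" "e4 \<in> S" "distinct [e1, e2, e3, e4]"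
    using es M by auto
  define r :: "'a \<times> 'b \<Rightarrow> 'a \<times> 'b \<Rightarrow> bool"
    where "r e f \<longleftrightarrow> (fst e, snd f) \<in> E" for e f
  have total: "r e f \<or> r f e" if "e \<in> S" "f \<in> S" for e f
    using strong[of "fst e" "snd e" "fst f" "snd f"] that by (simp add: r_def)
  have trans: False if "e \<in> S" "f \<in> S" "g \<in> S" "e \<noteq> f" "f \<noteq> g" "e \<noteq> g" "r e f" "r f g" "r e g" for e f g
  proof -
    have "fst e \<noteq> fst f" "snd f \<noteq> snd g"
      using assms(2) that unfolding matching_def by (metis (mono_tags, lifting) case_prodD prod.collapse)+
    moreover have "(fst f, snd f) \<in> E" using that S_sub by auto
    ultimately show False
      using even_cycle_2I[of "fst e" "snd f" E "snd g" "fst f"] that no by (auto simp: r_def)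
  qed
  have out: False if "e \<in> S" "f \<in> S" "g \<in> S" "e \<noteq> f" "f \<noteq> g" "e \<noteq> g" "r e f" "r e g" for e f g
    using trans total that by metis
  have inc: False if "e \<in> S" "f \<in> S" "g \<in> S" "e \<noteq> f" "f \<noteq> g" "e \<noteq> g" "r f e" "r g e" for e f g
    using trans total that by metis
  show False
    using total[of e1 e2] total[of e1 e3] total[of e1 e4] e
      out[of e1 e2 e3] out[of e1 e2 e4] out[of e1 e3 e4] inc[of e1 e2 e3] inc[of e1 e2 e4] inc[of e1 e3 e4]
    by auto
qed

lemma (in strong_clique_rel) no_even_cycle_2_card:
  assumes no: "\<not> even_cycle 2 E" and "2 \<le> D"
  shows "card S + 1 \<le> 2 * D"
proof -
  interpret conv: strong_clique_rel "E\<inverse>" "S\<inverse>" D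
    by (rule strong_clique_rel_converse) unfold_locales
  consider "matching S" | x y z where "(x, y) \<in> S" "(x, z) \<in> S" "y \<noteq> z"
    | x y z where "(y, x) \<in> S" "(z, x) \<in> S" "y \<noteq> z"
    by (fastforce simp: matching_def)
  then show ?thesis
  proof cases
    case 1
    then show ?thesis using no_even_cycle_2_matching no assms(2) by fastforce
  next
    case 2
    then show ?thesis using no_even_cycle_2_star no by metis
  next
    case 3
    moreover have "\<not> even_cycle 2 (E\<inverse>)" using no even_cycle_converse by blast
    ultimately show ?thesis using conv.no_even_cycle_2_star[of x y z] by simp
  qed
qed

section \<open>Large strong cliques with a cover of size k\<close>

text \<open>
  The number of edges that \<open>a\<close> wastes: neither private edges of \<open>S\<close> nor edges to the other half \<open>Q\<close> of
  the cover. The subtraction does not truncate, see \<open>deg_split\<close>.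
\<close>

definition slack :: "('a \<times> 'b) set \<Rightarrow> ('a \<times> 'b) set \<Rightarrow> nat \<Rightarrow> 'b set \<Rightarrow> 'a \<Rightarrow> nat" where
  "slack E S D Q a = D - (card (S `` {a} - Q) + card (E `` {a} \<inter> Q))"

locale large_covered_clique = strong_clique_rel E S D
  for E S :: "('a \<times> 'b) set" and D :: nat +
  fixes P :: "'a set" and Q :: "'b set" and k :: nat
  assumes cov: "covers S P Q" and k_eq: "card P + card Q = k" and k_le: "k \<le> D"
    and large: "k * D + 2 \<le> card S + k"

lemma large_covered_clique_converse:
  assumes "large_covered_clique E S D P Q k"
  shows "large_covered_clique (E\<inverse>) (S\<inverse>) D Q P k"
proof -
  interpret large_covered_clique E S D P Q k by fact
  interpret conv: strong_clique_rel "E\<inverse>" "S\<inverse>" D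
    by (rule strong_clique_rel_converse) unfold_locales
  show ?thesis
    by unfold_locales (use cov k_eq k_le large in \<open>auto simp: covers_converse\<close>)
qed

lemma card_Int_Times:
  assumes "finite P" "\<And>a. finite (E `` {a})"
  shows "card (E \<inter> P \<times> Q) = (\<Sum>a\<in>P. card (E `` {a} \<inter> Q))"
proof -
  have "E \<inter> P \<times> Q = (SIGMA a:P. E `` {a} \<inter> Q)" by auto
  then show ?thesis using assms by (simp add: card_SigmaI)
qed

lemma (in strong_clique_rel) deg_split:
  "card (S `` {a} - Q) + card (E `` {a} \<inter> Q) + slack E S D Q a = D"
proof -
  have "card (S `` {a} - Q) + card (E `` {a} \<inter> Q) = card ((S `` {a} - Q) \<union> (E `` {a} \<inter> Q))"
    by (rule card_Un_disjoint[symmetric]) auto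
  also have "\<dots> \<le> card (E `` {a})" using S_sub by (intro card_mono) auto
  finally show ?thesis using deg_left[of a] by (simp add: slack_def)
qed

lemma (in strong_clique_rel) slack_zeroD:
  assumes "slack E S D Q a = 0"
  shows "E `` {a} - Q = S `` {a} - Q"
proof -
  have "card (E `` {a}) = card (E `` {a} - Q) + card (E `` {a} \<inter> Q)"
    by (metis card_Diff_subset_Int card_mono finite_Int finite_nbrs(1) inf_le1 le_add_diff_inverse2)
  then have "card (E `` {a} - Q) \<le> card (S `` {a} - Q)"
    using deg_split[of a Q] deg_left[of a] assms by linarith
  then show ?thesis using S_sub by (intro card_seteq[symmetric]) auto
qed

lemma (in strong_clique_rel) common_nbrs:
  "min (card (S `` {a} - Q)) (card (S `` {b} - Q)) \<le> card ((E `` {a} - Q) \<inter> (E `` {b} - Q))"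
proof -
  have "S `` {a} \<subseteq> E `` {b} \<or> S `` {b} \<subseteq> E `` {a}"
    using strong[of a _ b _] by blast
  then have "S `` {a} - Q \<subseteq> (E `` {a} - Q) \<inter> (E `` {b} - Q) \<or>
      S `` {b} - Q \<subseteq> (E `` {a} - Q) \<inter> (E `` {b} - Q)"
    using S_left_sub[of a] S_left_sub[of b] by blast
  then show ?thesis by (meson card_mono finite_Diff finite_Int finite_nbrs(1) min.coboundedI1 min.coboundedI2)
qed

context large_covered_clique
begin

lemma fin_PQ [simp]: "finite P" "finite Q"
  using cov by (auto simp: covers_def)

lemma sum_deg_left:
  "(\<Sum>a\<in>P. card (S `` {a} - Q)) + card (E \<inter> P \<times> Q) + (\<Sum>a\<in>P. slack E S D Q a) = card P * D"
  using deg_split by (simp add: card_Int_Times flip: sum.distrib)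

end

context large_covered_clique
begin

interpretation conv: large_covered_clique "E\<inverse>" "S\<inverse>" D Q P k
  by (rule large_covered_clique_converse) unfold_locales

lemma card_converse_Int: "card (E\<inverse> \<inter> Q \<times> P) = card (E \<inter> P \<times> Q)"
  by (metis card_inverse converse_Int converse_Times converse_converse)

lemma budget:
  "card (E \<inter> P \<times> Q) + (\<Sum>a\<in>P. slack E S D Q a) + (\<Sum>b\<in>Q. slack (E\<inverse>) (S\<inverse>) D P b) + 2 \<le> k"
proof -
  let ?A = "SIGMA a:P. S `` {a} - Q" and ?B = "SIGMA b:Q. S\<inverse> `` {b} - P"
  have "S \<subseteq> ?A \<union> ?B\<inverse> \<union> (E \<inter> P \<times> Q)"
    using cov S_sub by (fastforce simp: covers_def)
  then have "card S \<le> card (?A \<union> ?B\<inverse> \<union> (E \<inter> P \<times> Q))"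
    using finE by (intro card_mono) auto
  also have "\<dots> \<le> card ?A + card ?B + card (E \<inter> P \<times> Q)"
    by (metis (no_types, lifting) add_le_mono1 card_Un_le card_inverse le_trans)
  also have "card ?A = (\<Sum>a\<in>P. card (S `` {a} - Q))" by (simp add: card_SigmaI)
  also have "card ?B = (\<Sum>b\<in>Q. card (S\<inverse> `` {b} - P))" by (simp add: card_SigmaI)
  finally have "card S \<le> (\<Sum>a\<in>P. card (S `` {a} - Q)) + (\<Sum>b\<in>Q. card (S\<inverse> `` {b} - P)) + card (E \<inter> P \<times> Q)" .
  moreover have "k * D = card P * D + card Q * D" using k_eq by (simp flip: distrib_right)
  ultimately show ?thesis
    using sum_deg_left conv.sum_deg_left[unfolded card_converse_Int] large by linarith
qed

lemma sum_loss: "(\<Sum>a\<in>P. D - card (S `` {a} - Q)) + 2 \<le> k"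
proof -
  have "D - card (S `` {a} - Q) = card (E `` {a} \<inter> Q) + slack E S D Q a" for a
    using deg_split[of a Q] by linarith
  then have "(\<Sum>a\<in>P. D - card (S `` {a} - Q)) = card (E \<inter> P \<times> Q) + (\<Sum>a\<in>P. slack E S D Q a)"
    by (simp add: card_Int_Times sum.distrib)
  then show ?thesis using budget by linarith
qed

end

context large_covered_clique
begin

interpretation conv: large_covered_clique "E\<inverse>" "S\<inverse>" D Q P k
  by (rule large_covered_clique_converse) unfold_locales

lemma count_low_degree:
  assumes "\<And>a. a \<in> P \<Longrightarrow> m \<le> D - card (S `` {a} - Q)"
  defines "n t \<equiv> card {a \<in> P. card (S `` {a} - Q) \<le> t}"
  shows "n t * (D - t) + (card P - n t) * m + 2 \<le> k"
proof -
  let ?L = "{a \<in> P. card (S `` {a} - Q) \<le> t}"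
  have "n t * (D - t) \<le> (\<Sum>a\<in>?L. D - card (S `` {a} - Q))"
    using sum_bounded_below[of ?L "D - t" "\<lambda>a. D - card (S `` {a} - Q)"] by (force simp: n_def)
  moreover have "card (P - ?L) * m \<le> (\<Sum>a\<in>P - ?L. D - card (S `` {a} - Q))"
    using sum_bounded_below[of "P - ?L" m "\<lambda>a. D - card (S `` {a} - Q)"] assms(1) by simp
  moreover have "card (P - ?L) = card P - n t"
    unfolding n_def by (intro card_Diff_subset) auto
  moreover have "(\<Sum>a\<in>P. D - card (S `` {a} - Q)) =
      (\<Sum>a\<in>P - ?L. D - card (S `` {a} - Q)) + (\<Sum>a\<in>?L. D - card (S `` {a} - Q))"
    by (intro sum.subset_diff) auto
  ultimately show ?thesis using sum_loss by simp
qed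

lemma count_low_degree_less:
  assumes "t < k" "{a \<in> P. card (S `` {a} - Q) \<le> t} \<noteq> {}"
  shows "card {a \<in> P. card (S `` {a} - Q) \<le> t} < t"
proof (rule ccontr)
  define n where "n = card {a \<in> P. card (S `` {a} - Q) \<le> t}"
  assume "\<not> card {a \<in> P. card (S `` {a} - Q) \<le> t} < t"
  then have "t \<le> n" by (simp add: n_def)
  have "0 < n" using assms(2) by (simp add: n_def card_gt_0_iff)
  obtain m where m: "n = Suc m" using \<open>0 < n\<close> by (cases n) auto
  obtain j where j: "k = t + Suc j" using assms(1) by (metis less_iff_Suc_add add_Suc_right)
  have "n * (k - t) \<le> n * (D - t)" using k_le by (intro mult_le_mono2 diff_le_mono)
  moreover have "n * (D - t) + 2 \<le> k" using count_low_degree[of 0 t] by (simp add: n_def)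
  ultimately have "n * (k - t) + 2 \<le> k" by linarith
  then show False using m j \<open>t \<le> n\<close> by simp
qed

text \<open>
  A vertex \<open>z\<close> of \<open>P\<close> without loss has no neighbour in \<open>Q\<close>. The cycle consists of \<open>P\<close>, in the order of
  the chain, and then \<open>card Q\<close> private neighbours of a vertex of \<open>Q\<close>, all of which see all of
  \<open>S `` {z} - Q\<close>.
\<close>

lemma full_degree_imp_even_cycle:
  assumes z: "z \<in> P" "card (S `` {z} - Q) = D"
  shows "even_cycle k E"
proof -
  define p q where "p = card P" and "q = card Q"
  have pq: "p + q = k" by (simp add: p_def q_def k_eq)
  have "0 < p" using z by (auto simp: p_def card_gt_0_iff)
  have z0: "slack E S D Q z = 0" "E `` {z} \<inter> Q = {}"
    using deg_split[of z Q] z(2) by auto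
  have Mz: "E `` {z} - Q = S `` {z} - Q" by (rule slack_zeroD[OF z0(1)])
  obtain c y where c: "bij_betw c {..<p} P" "c (p - 1) = z" and y: "inj_on y {..<p + q}"
    "y 0 \<in> E `` {c 0} - Q" "y 0 \<in> E `` {z} - Q"
    "\<And>i. 0 < i \<Longrightarrow> i < p \<Longrightarrow> y i \<in> (E `` {c (i - 1)} - Q) \<inter> (E `` {c i} - Q)"
    "\<And>i. p \<le> i \<Longrightarrow> i < p + q \<Longrightarrow> y i \<in> E `` {z} - Q"
  proof (rule ex_chain[of P z "\<lambda>a. card (S `` {a} - Q)" "\<lambda>a. E `` {a} - Q" q, folded p_def])
    show "card {c \<in> P. card (S `` {c} - Q) \<le> t} < t"
      if "t < p + q" "{c \<in> P. card (S `` {c} - Q) \<le> t} \<noteq> {}" for t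
      using count_low_degree_less that pq by simp
    show "card {c \<in> P. card (S `` {c} - Q) \<le> t} + 1 + q \<le> t"
      if "t < p + q" "card (S `` {z} - Q) \<le> t" for t
      using that z(2) k_le pq by simp
  qed (use z common_nbrs in auto)
  obtain X where X: "card X = q" "X \<inter> P = {}" "\<And>x b. x \<in> X \<Longrightarrow> b \<in> E `` {z} - Q \<Longrightarrow> (x, b) \<in> E" "finite X"
  proof (cases "q = 0")
    case True
    then show ?thesis using that[of "{}"] by simp
  next
    case False
    have "\<exists>w\<in>Q. q \<le> card (S\<inverse> `` {w} - P)"
    proof (rule ccontr)
      assume "\<not> ?thesis"
      then have "Suc p \<le> D - card (S\<inverse> `` {w} - P)" if "w \<in> Q" for w
        using that k_le pq by (fastforce simp: not_le)
      then have "q * Suc p + 2 \<le> k"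
        using sum_bounded_below[of Q "Suc p" "\<lambda>w. D - card (S\<inverse> `` {w} - P)"] conv.sum_loss
        by (simp add: q_def)
      then show False using pq \<open>0 < p\<close> False by (cases q; cases p) auto
    qed
    then obtain w where w: "w \<in> Q" "q \<le> card (S\<inverse> `` {w} - P)" by blast
    then obtain X where X: "X \<subseteq> S\<inverse> `` {w} - P" "card X = q" "finite X"
      by (meson obtain_subset_with_card_n)
    have "(x, b) \<in> E" if "x \<in> X" "b \<in> E `` {z} - Q" for x b
    proof -
      have "(x, w) \<in> S" "(z, b) \<in> S" using that X(1) Mz by auto
      then show ?thesis using strong z0(2) w(1) by blast
    qed
    then show ?thesis using that[of X] X by blast
  qed
  obtain f where f: "bij_betw f {0..<q} X" using ex_bij_betw_nat_finite X(1,4) by metis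
  define x where "x i = (if i < p then c i else f (i - p))" for i
  have cP: "c i \<in> P" if "i < p" for i using c(1) that by (auto simp: bij_betw_def)
  have fX: "f i \<in> X" if "i < q" for i using f that by (auto simp: bij_betw_def)
  have tail: "(x i, b) \<in> E" if "p - 1 \<le> i" "i < k" "b \<in> E `` {z} - Q" for i b
  proof (cases "i < p")
    case True
    then have "i = p - 1" using that(1) by simp
    then show ?thesis using c(2) that True by (simp add: x_def)
  next
    case False
    then show ?thesis using X(3) fX[of "i - p"] that pq by (simp add: x_def)
  qed
  have "inj_on x {..<k}"
  proof (rule inj_onI)
    fix i j assume ij: "i \<in> {..<k}" "j \<in> {..<k}" "x i = x j"
    have "c i \<noteq> f (j - p)" if "i < p" "\<not> j < p" "j < k" for i j
      using cP[OF that(1)] fX[of "j - p"] that X(2) pq by (metis disjoint_iff add.commute less_diff_conv2 not_less)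
    then have "(i < p) = (j < p)" using ij by (metis lessThan_iff x_def)
    moreover have "i = j" if "i < p" "j < p"
      using ij that c(1) by (auto simp: x_def bij_betw_def inj_on_def)
    moreover have "i = j" if "\<not> i < p" "\<not> j < p"
    proof -
      have "i - p \<in> {0..<q}" "j - p \<in> {0..<q}" using that ij pq by auto
      then have "i - p = j - p"
        using ij that f by (auto simp: x_def bij_betw_def dest: inj_onD)
      then show ?thesis using that by simp
    qed
    ultimately show "i = j" by blast
  qed
  moreover have "inj_on y {..<k}" using y(1) pq by simp
  moreover have "(x i, y i) \<in> E" if "i < k" for i
  proof -
    consider "i = 0" | "0 < i" "i < p" | "p \<le> i" by (metis neq0_conv not_le)
    then show ?thesis
    proof cases
      case 1
      then show ?thesis using y(2) \<open>0 < p\<close> by (simp add: x_def)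
    next
      case 2
      then show ?thesis using y(4)[of i] by (simp add: x_def)
    next
      case 3
      then show ?thesis using y(5)[of i] tail[of i "y i"] that pq by simp
    qed
  qed
  moreover have "(x i, y (Suc i mod k)) \<in> E" if "i < k" for i
  proof -
    have "Suc i = k \<or> Suc i < p \<and> Suc i < k \<or> p \<le> Suc i \<and> Suc i < k" using that by linarith
    then consider "Suc i = k" | "Suc i < p" "Suc i < k" | "p \<le> Suc i" "Suc i < k" by blast
    then show ?thesis
    proof cases
      case 1
      then show ?thesis using y(3) tail[of i "y 0"] that pq by simp
    next
      case 2
      then show ?thesis using y(4)[of "Suc i"] by (simp add: x_def)
    next
      case 3
      then show ?thesis using y(5)[of "Suc i"] tail[of i "y (Suc i)"] pq by simp
    qed
  qed
  ultimately show ?thesis unfolding even_cycle_def by blast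
qed

lemma ex_chain_no_full_degree:
  assumes "\<And>a. a \<in> P \<Longrightarrow> card (S `` {a} - Q) < D" "2 \<le> card P" "2 \<le> card Q"
    and z: "z \<in> P" "slack E S D Q z = 0"
  obtains c y where "bij_betw c {..<card P} P" "c (card P - 1) = z" "inj_on y {..card P}"
    "(c 0, y 0) \<in> E" "\<And>i. 0 < i \<Longrightarrow> i < card P \<Longrightarrow> (c (i - 1), y i) \<in> E \<and> (c i, y i) \<in> E"
    "\<And>i. i = 0 \<or> i = card P - 1 \<or> i = card P \<Longrightarrow> (z, y i) \<in> S"
    "\<And>i. i \<le> card P \<Longrightarrow> y i \<notin> Q"
proof -
  define p where "p = card P"
  have p: "2 \<le> p" using assms by (simp add: p_def)
  have Mz: "E `` {z} - Q = S `` {z} - Q" by (rule slack_zeroD[OF z(2)])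
  obtain c y where c: "bij_betw c {..<p} P" "c (p - 1) = z" and y: "inj_on y {..<p + 1}"
    "y 0 \<in> E `` {c 0} - Q" "y 0 \<in> E `` {z} - Q"
    "\<And>i. 0 < i \<Longrightarrow> i < p \<Longrightarrow> y i \<in> (E `` {c (i - 1)} - Q) \<inter> (E `` {c i} - Q)"
    "\<And>i. p \<le> i \<Longrightarrow> i < p + 1 \<Longrightarrow> y i \<in> E `` {z} - Q"
  proof (rule ex_chain[of P z "\<lambda>a. card (S `` {a} - Q)" "\<lambda>a. E `` {a} - Q" 1, folded p_def])
    show "card {c \<in> P. card (S `` {c} - Q) \<le> t} < t"
      if "t < p + 1" "{c \<in> P. card (S `` {c} - Q) \<le> t} \<noteq> {}" for t
      using count_low_degree_less that assms(3) k_eq by (simp add: p_def)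
    show "card {c \<in> P. card (S `` {c} - Q) \<le> t} + 1 + 1 \<le> t"
      if t: "t < p + 1" and zt: "card (S `` {z} - Q) \<le> t" for t
    proof (rule ccontr)
      define n where "n = card {c \<in> P. card (S `` {c} - Q) \<le> t}"
      assume "\<not> ?thesis"
      then have n: "t \<le> n + 1" by (simp add: n_def)
      have "0 < n" using z zt by (auto simp: n_def card_gt_0_iff)
      have "n \<le> p" unfolding n_def p_def by (intro card_mono) auto
      have "1 \<le> D - card (S `` {a} - Q)" if "a \<in> P" for a using assms(1)[OF that] by simp
      then have "n * (D - t) + (p - n) + 2 \<le> k"
        using count_low_degree[of 1 t] by (simp add: n_def p_def)
      moreover have "n * (k - t) \<le> n * (D - t)" using k_le by (intro mult_le_mono2 diff_le_mono)
      ultimately have bound: "n * (k - t) + (p - n) + 2 \<le> k" by linarith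
      obtain j where j: "k = t + (j + 2)"
        using t assms(3) k_eq by (metis add.commute add.assoc le_Suc_ex less_Suc_eq_le p_def Suc_eq_plus1 add_mono_thms_linordered_semiring(1))
      obtain m where m: "n = Suc m" using \<open>0 < n\<close> by (cases n) auto
      show False using bound j m \<open>n \<le> p\<close> n p by simp
    qed
  qed (use z common_nbrs in auto)
  show ?thesis
  proof (rule that[of c y])
    show "y i \<notin> Q" if "i \<le> card P" for i
    proof -
      have "i = 0 \<or> 0 < i \<and> i < p \<or> i = p" using that unfolding p_def by linarith
      then consider "i = 0" | "0 < i" "i < p" | "i = p" by blast
      then show ?thesis using y(2) y(4)[of i] y(5)[of i] by cases auto
    qed
    show "(z, y i) \<in> S" if "i = 0 \<or> i = card P - 1 \<or> i = card P" for i
    proof -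
      have "i = 0 \<or> i = p - 1 \<or> i = p" using that by (simp add: p_def)
      then have "y i \<in> E `` {z} - Q" using y(3) y(4)[of "p - 1"] y(5)[of p] c(2) p by auto
      then show ?thesis using Mz by auto
    qed
    show "(c (i - 1), y i) \<in> E \<and> (c i, y i) \<in> E" if "0 < i" "i < card P" for i
      using y(4)[of i] that by (simp add: p_def)
  qed (use c y in \<open>auto simp: p_def lessThan_Suc_atMost\<close>)
qed

end

context large_covered_clique
begin

interpretation conv: large_covered_clique "E\<inverse>" "S\<inverse>" D Q P k
  by (rule large_covered_clique_converse) unfold_locales

lemma ex_nonadjacent_slack_zero:
  assumes left: "\<And>a. a \<in> P \<Longrightarrow> card (S `` {a} - Q) < D"
    and right: "\<And>b. b \<in> Q \<Longrightarrow> card (S\<inverse> `` {b} - P) < D"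
  obtains a b where "a \<in> P" "b \<in> Q" "slack E S D Q a = 0" "slack (E\<inverse>) (S\<inverse>) D P b = 0" "(a, b) \<notin> E"
proof (rule ccontr)
  define P1 where "P1 = {a \<in> P. slack E S D Q a = 0}"
  define Q1 where "Q1 = {b \<in> Q. slack (E\<inverse>) (S\<inverse>) D P b = 0}"
  let ?e = "card (E \<inter> P \<times> Q)"
  have fin: "finite P1" "finite Q1" "P1 \<subseteq> P" "Q1 \<subseteq> Q" by (auto simp: P1_def Q1_def)
  assume "\<not> thesis"
  then have "P1 \<times> Q1 \<subseteq> E \<inter> P \<times> Q" using that by (auto simp: P1_def Q1_def)
  then have e: "card P1 * card Q1 \<le> ?e"
    using card_mono[of "E \<inter> P \<times> Q" "P1 \<times> Q1"] finE by (simp add: card_cartesian_product)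
  have "1 \<le> card (E `` {a} \<inter> Q)" if "a \<in> P1" for a
    using deg_split[of a Q] left[of a] that by (simp add: P1_def)
  then have "card P1 \<le> (\<Sum>a\<in>P1. card (E `` {a} \<inter> Q))"
    using sum_bounded_below[of P1 1 "\<lambda>a. card (E `` {a} \<inter> Q)"] by simp
  also have "\<dots> \<le> ?e" using fin by (simp add: card_Int_Times sum_mono2)
  finally have eP: "card P1 \<le> ?e" .
  have "1 \<le> card (E\<inverse> `` {b} \<inter> P)" if "b \<in> Q1" for b
    using conv.deg_split[of b P] right[of b] that by (simp add: Q1_def)
  then have "card Q1 \<le> (\<Sum>b\<in>Q1. card (E\<inverse> `` {b} \<inter> P))"
    using sum_bounded_below[of Q1 1 "\<lambda>b. card (E\<inverse> `` {b} \<inter> P)"] by simp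
  also have "\<dots> \<le> (\<Sum>b\<in>Q. card (E\<inverse> `` {b} \<inter> P))" using fin by (intro sum_mono2) auto
  also have "\<dots> = ?e" using card_Int_Times[of Q "E\<inverse>" P] finE by (simp add: card_converse_Int)
  finally have eQ: "card Q1 \<le> ?e" .
  have "card (P - P1) \<le> (\<Sum>a\<in>P - P1. slack E S D Q a)"
    using sum_bounded_below[of "P - P1" 1 "slack E S D Q"] by (simp add: P1_def Suc_le_eq)
  also have "\<dots> \<le> (\<Sum>a\<in>P. slack E S D Q a)" by (intro sum_mono2) auto
  finally have sP: "card P - card P1 \<le> (\<Sum>a\<in>P. slack E S D Q a)" using fin by (simp add: card_Diff_subset)
  have "card (Q - Q1) \<le> (\<Sum>b\<in>Q - Q1. slack (E\<inverse>) (S\<inverse>) D P b)"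
    using sum_bounded_below[of "Q - Q1" 1 "slack (E\<inverse>) (S\<inverse>) D P"] by (simp add: Q1_def Suc_le_eq)
  also have "\<dots> \<le> (\<Sum>b\<in>Q. slack (E\<inverse>) (S\<inverse>) D P b)" by (intro sum_mono2) auto
  finally have sQ: "card Q - card Q1 \<le> (\<Sum>b\<in>Q. slack (E\<inverse>) (S\<inverse>) D P b)" using fin by (simp add: card_Diff_subset)
  have "card P1 + card Q1 \<le> ?e + 1"
  proof (cases "card P1 = 0 \<or> card Q1 = 0")
    case True
    then show ?thesis using eP eQ by auto
  next
    case False
    then have "card P1 + card Q1 \<le> card P1 * card Q1 + 1"
      by (cases "card P1"; cases "card Q1") auto
    then show ?thesis using e by linarith
  qed
  moreover have "card P1 \<le> card P" "card Q1 \<le> card Q" using fin by (auto intro: card_mono)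
  ultimately show False using budget k_eq sP sQ by linarith
qed

text \<open>
  The chains through \<open>P\<close> and \<open>Q\<close> would close up to a cycle of length \<open>2k + 2\<close>, so the last vertex of
  the chain through \<open>Q\<close> is left out.
\<close>

lemma no_full_degree_imp_even_cycle:
  assumes left: "\<And>a. a \<in> P \<Longrightarrow> card (S `` {a} - Q) < D"
    and right: "\<And>b. b \<in> Q \<Longrightarrow> card (S\<inverse> `` {b} - P) < D"
  shows "even_cycle k E"
proof -
  define p q where "p = card P" and "q = card Q"
  have pq: "p + q = k" by (simp add: p_def q_def k_eq)
  have "card P \<le> (\<Sum>a\<in>P. D - card (S `` {a} - Q))"
    using sum_bounded_below[of P 1 "\<lambda>a. D - card (S `` {a} - Q)"] left by (simp add: Suc_le_eq)
  then have q: "2 \<le> q" using sum_loss pq by (simp add: p_def)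
  have "card Q \<le> (\<Sum>b\<in>Q. D - card (S\<inverse> `` {b} - P))"
    using sum_bounded_below[of Q 1 "\<lambda>b. D - card (S\<inverse> `` {b} - P)"] right by (simp add: Suc_le_eq)
  then have p: "2 \<le> p" using conv.sum_loss pq by (simp add: q_def)
  obtain a b where ab: "a \<in> P" "b \<in> Q" "slack E S D Q a = 0" "slack (E\<inverse>) (S\<inverse>) D P b = 0" "(a, b) \<notin> E"
    using ex_nonadjacent_slack_zero[OF left right] by blast
  obtain c y where c: "bij_betw c {..<p} P" and y: "inj_on y {..p}" "(c 0, y 0) \<in> E"
    "\<And>i. 0 < i \<Longrightarrow> i < p \<Longrightarrow> (c (i - 1), y i) \<in> E \<and> (c i, y i) \<in> E"
    "\<And>i. i = 0 \<or> i = p - 1 \<or> i = p \<Longrightarrow> (a, y i) \<in> S"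
    "\<And>i. i \<le> p \<Longrightarrow> y i \<notin> Q" and c_last: "c (p - 1) = a"
    using ex_chain_no_full_degree[OF left _ _ ab(1,3)] p q unfolding p_def q_def by metis
  obtain c' x where c': "bij_betw c' {..<q} Q" and x: "inj_on x {..q}" "(c' 0, x 0) \<in> E\<inverse>"
    "\<And>i. 0 < i \<Longrightarrow> i < q \<Longrightarrow> (c' (i - 1), x i) \<in> E\<inverse> \<and> (c' i, x i) \<in> E\<inverse>"
    "\<And>i. i = 0 \<or> i = q - 1 \<or> i = q \<Longrightarrow> (b, x i) \<in> S\<inverse>"
    "\<And>i. i \<le> q \<Longrightarrow> x i \<notin> P"
    using conv.ex_chain_no_full_degree[OF right _ _ ab(2,4)] p q unfolding p_def q_def by metis
  have complete: "(x i, y j) \<in> E" if "i = 0 \<or> i = q - 1" "j = 0 \<or> j = p" for i j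
  proof -
    have "(a, y j) \<in> S" "(x i, b) \<in> S" using y(4) x(4) that by auto
    then show ?thesis using strong ab(5) by blast
  qed
  have cP: "c i \<in> P" if "i < p" for i using c that by (auto simp: bij_betw_def)
  have cQ: "c' i \<in> Q" if "i < q" for i using c' that by (auto simp: bij_betw_def)
  define u where "u i = (if i < p then c i else x (i - p))" for i
  define w where "w i = (if i \<le> p then y i else c' (i - p - 1))" for i
  have "inj_on u {..<k}"
  proof (rule inj_onI)
    fix i j assume ij: "i \<in> {..<k}" "j \<in> {..<k}" "u i = u j"
    have "c i \<noteq> x (j - p)" if "i < p" "j < k" for i j
      using cP[OF that(1)] x(5)[of "j - p"] that pq by auto
    then have "(i < p) = (j < p)" using ij by (metis lessThan_iff u_def)
    moreover have "i = j" if "i < p" "j < p"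
      using ij that c by (auto simp: u_def bij_betw_def inj_on_def)
    moreover have "i = j" if "\<not> i < p" "\<not> j < p"
    proof -
      have "i - p \<in> {..q}" "j - p \<in> {..q}" using that ij pq by auto
      then have "i - p = j - p"
        using ij that x(1) by (auto simp: u_def dest: inj_onD)
      then show ?thesis using that by simp
    qed
    ultimately show "i = j" by blast
  qed
  moreover have "inj_on w {..<k}"
  proof (rule inj_onI)
    fix i j assume ij: "i \<in> {..<k}" "j \<in> {..<k}" "w i = w j"
    have "y i \<noteq> c' (j - p - 1)" if "i \<le> p" "j < k" for i j
      using cQ[of "j - p - 1"] y(5)[OF that(1)] that pq q by auto
    then have "(i \<le> p) = (j \<le> p)" using ij by (metis lessThan_iff w_def)
    moreover have "i = j" if "i \<le> p" "j \<le> p"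
      using ij that y(1) by (auto simp: w_def inj_on_def)
    moreover have "i = j" if "\<not> i \<le> p" "\<not> j \<le> p"
    proof -
      have "i - p - 1 \<in> {..<q}" "j - p - 1 \<in> {..<q}" using that ij pq by auto
      then have "i - p - 1 = j - p - 1"
        using ij that c' by (auto simp: w_def bij_betw_def dest: inj_onD)
      then show ?thesis using that by simp
    qed
    ultimately show "i = j" by blast
  qed
  moreover have "(u i, w i) \<in> E" if "i < k" for i
  proof -
    consider "i = 0" | "0 < i" "i < p" | "i = p" | "p < i" by (metis neq0_conv nat_neq_iff)
    then show ?thesis
    proof cases
      case 1
      then show ?thesis using y(2) p by (simp add: u_def w_def)
    next
      case 2
      then show ?thesis using y(3)[of i] by (simp add: u_def w_def)
    next
      case 3
      then show ?thesis using complete[of 0 p] by (simp add: u_def w_def)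
    next
      case 4
      then show ?thesis using x(3)[of "i - p"] that pq by (simp add: u_def w_def)
    qed
  qed
  moreover have "(u i, w (Suc i mod k)) \<in> E" if "i < k" for i
  proof -
    have "Suc i < p \<or> Suc i = p \<or> i = p \<or> p < i \<and> Suc i < k \<or> p < i \<and> Suc i = k"
      using that by linarith
    then consider "Suc i < p" | "Suc i = p" | "i = p" | "p < i" "Suc i < k" | "p < i" "Suc i = k"
      by blast
    then show ?thesis
    proof cases
      case 1
      then show ?thesis using y(3)[of "Suc i"] pq by (simp add: u_def w_def)
    next
      case 2
      then have "i = p - 1" "Suc i mod k = p" using pq q by auto
      then show ?thesis using y(4)[of p] c_last 2 S_sub by (auto simp: u_def w_def)
    next
      case 3
      then have "Suc i mod k = Suc p" using pq q by simp
      then show ?thesis using x(2) 3 by (simp add: u_def w_def)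
    next
      case 4
      then show ?thesis using x(3)[of "i - p"] pq by (simp add: u_def w_def)
    next
      case 5
      then have "i - p = q - 1" using pq by linarith
      then show ?thesis using complete[of "q - 1" 0] 5 by (simp add: u_def w_def)
    qed
  qed
  ultimately show ?thesis unfolding even_cycle_def by blast
qed

lemma even_cycle: "even_cycle k E"
proof -
  have le: "card (S `` {a} - Q) \<le> D" "card (S\<inverse> `` {b} - P) \<le> D" for a b
    using deg_split[of a Q] conv.deg_split[of b P] by linarith+
  consider a where "a \<in> P" "card (S `` {a} - Q) = D" | b where "b \<in> Q" "card (S\<inverse> `` {b} - P) = D"
    | "\<And>a. a \<in> P \<Longrightarrow> card (S `` {a} - Q) < D" "\<And>b. b \<in> Q \<Longrightarrow> card (S\<inverse> `` {b} - P) < D"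
    using le by (meson le_neq_implies_less)
  then show ?thesis
  proof cases
    case 1
    then show ?thesis by (rule full_degree_imp_even_cycle)
  next
    case 2
    then show ?thesis using conv.full_degree_imp_even_cycle even_cycle_converse by blast
  next
    case 3
    then show ?thesis by (rule no_full_degree_imp_even_cycle)
  qed
qed

end

theorem (in strong_clique_rel) card_le_if_no_even_cycle:
  assumes "2 \<le> k" "1 \<le> D" and no: "\<not> even_cycle k E"
  shows "card S + k \<le> k * D + 1"
proof (cases "D < k")
  case True
  have "D * D + k \<le> k * D + 1"
  proof -
    obtain i j where "D = Suc i" "k = Suc i + Suc j" using True assms(2)
      by (metis One_nat_def Suc_le_D add_Suc_right less_iff_Suc_add)
    then show ?thesis by (simp add: algebra_simps)
  qed
  then show ?thesis using card_le_square by linarith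
next
  case False
  obtain M P Q where M: "M \<subseteq> S" "matching M" and PQ: "covers S P Q" "card P + card Q \<le> card M"
    using koenig[OF finS] by blast
  show ?thesis
  proof (cases "k = 2")
    case True
    then show ?thesis using no_even_cycle_2_card no False by simp
  next
    case k2: False
    have "card M \<le> k"
    proof (rule ccontr)
      assume "\<not> card M \<le> k"
      then obtain M' where "M' \<subseteq> M" "card M' = Suc k"
        using obtain_subset_with_card_n[of "Suc k" M] by auto
      moreover have "matching M'" using M(2) \<open>M' \<subseteq> M\<close> unfolding matching_def split_beta by blast
      ultimately show False
        using matching_imp_even_cycle[of M' k] M(1) \<open>M' \<subseteq> M\<close> no k2 assms(1) by auto
    qed
    then consider "card P + card Q = k" | "card P + card Q < k" using PQ(2) by linarith
    then show ?thesis
    proof cases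
      case 1
      show ?thesis
      proof (rule ccontr)
        assume "\<not> ?thesis"
        then interpret large_covered_clique E S D P Q k
          using 1 PQ(1) False by unfold_locales auto
        show False using even_cycle no by blast
      qed
    next
      case 2
      have fin: "finite P" "finite Q" using PQ(1) by (auto simp: covers_def)
      have "S \<subseteq> (SIGMA a:P. S `` {a}) \<union> (SIGMA b:Q. S\<inverse> `` {b})\<inverse>"
        using PQ(1) by (fastforce simp: covers_def)
      then have "card S \<le> card ((SIGMA a:P. S `` {a}) \<union> (SIGMA b:Q. S\<inverse> `` {b})\<inverse>)"
        using fin by (intro card_mono) auto
      also have "\<dots> \<le> card (SIGMA a:P. S `` {a}) + card (SIGMA b:Q. S\<inverse> `` {b})"
        by (metis card_Un_le card_inverse)
      also have "\<dots> = (\<Sum>a\<in>P. card (S `` {a})) + (\<Sum>b\<in>Q. card (S\<inverse> `` {b}))"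
        using fin by (simp add: card_SigmaI)
      also have "\<dots> \<le> card P * D + card Q * D"
        using sum_bounded_above[of P "\<lambda>a. card (S `` {a})" D] degS_left
          sum_bounded_above[of Q "\<lambda>b. card (S\<inverse> `` {b})" D] degS_right by (simp add: add_mono)
      also have "\<dots> = (card P + card Q) * D" by (simp add: distrib_right)
      also have "\<dots> \<le> (k - 1) * D" using 2 by (intro mult_right_mono) auto
      finally have "card S \<le> (k - 1) * D" .
      moreover have "(k - 1) * D + D = k * D" using assms(1) by (cases k) auto
      ultimately show ?thesis using False by linarith
    qed
  qed
qed

section \<open>Transfer to graphs\<close>

lemma even_cycle_imp_not_free_of:
  assumes "even_cycle k E" "A \<inter> B = {}" "simple_graph G"
    and E: "\<And>a b. (a, b) \<in> E \<Longrightarrow> a \<in> A \<and> b \<in> B \<and> {a, b} \<in> edges G"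
  shows "\<not> free_of (cycle_graph (2 * k)) G"
proof -
  obtain x y where x: "inj_on x {..<k}" and y: "inj_on y {..<k}"
    and xy: "\<And>i. i < k \<Longrightarrow> (x i, y i) \<in> E" "\<And>i. i < k \<Longrightarrow> (x i, y (Suc i mod k)) \<in> E"
    using assms(1) by (auto simp: even_cycle_def)
  define f where "f j = (if even j then y (j div 2) else x (j div 2))" for j
  let ?C = "cycle_graph (2 * k)"
  define H where "H = \<lparr>verts = f ` {..<2 * k}, edges = (`) f ` edges ?C\<rparr>"
  have half: "j div 2 < k" if "j < 2 * k" for j using that by linarith
  have "inj_on f {..<2 * k}"
  proof (rule inj_onI)
    fix i j assume ij: "i \<in> {..<2 * k}" "j \<in> {..<2 * k}" "f i = f j"
    have lt: "i div 2 < k" "j div 2 < k" using half[of i] half[of j] ij(1,2) by (simp_all only: lessThan_iff)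
    have "x m \<noteq> y n" if "m < k" "n < k" for m n
    proof -
      have "x m \<in> A" "y n \<in> B" using E[OF xy(1)] that by auto
      then show ?thesis using assms(2) by auto
    qed
    then have par: "even i = even j" using ij(3) lt unfolding f_def by (metis (full_types))
    moreover have "i div 2 = j div 2"
    proof (cases "even i")
      case True
      then have "y (i div 2) = y (j div 2)" using ij(3) par by (simp add: f_def)
      then show ?thesis using inj_onD[OF y] lt by (simp only: lessThan_iff)
    next
      case False
      then have "x (i div 2) = x (j div 2)" using ij(3) par by (simp add: f_def)
      then show ?thesis using inj_onD[OF x] lt by (simp only: lessThan_iff)
    qed
    ultimately show "i = j" by (metis even_two_times_div_two odd_two_times_div_two_succ)
  qed
  note f_inj = this
  have C_sub: "e \<subseteq> {..<2 * k}" if "e \<in> edges ?C" for e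
    using that by (auto simp: cycle_graph_def)
  have "f ` e \<in> edges G" if e: "e \<in> edges ?C" for e
  proof -
    obtain i where i: "i < 2 * k" "e = {i, (i + 1) mod (2 * k)}"
      using e by (auto simp: cycle_graph_def)
    define j where "j = i div 2"
    have j: "j < k" using half[OF i(1)] by (simp add: j_def)
    show ?thesis
    proof (cases "even i")
      case True
      then have "i = 2 * j" by (simp add: j_def)
      moreover have "(i + 1) mod (2 * k) = 2 * j + 1" using \<open>i = 2 * j\<close> j by simp
      ultimately have "f ` e = {x j, y j}" using i(2) by (auto simp: f_def)
      then show ?thesis using E[OF xy(1)[OF j]] by simp
    next
      case False
      then have i2: "i = 2 * j + 1" by (simp add: j_def)
      then have "i + 1 = 2 * Suc j" by simp
      then have "(i + 1) mod (2 * k) = 2 * (Suc j mod k)" by (metis mult_mod_right)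
      then have "f ` e = {x j, y (Suc j mod k)}" using i(2) i2 by (auto simp: f_def)
      then show ?thesis using E[OF xy(2)[OF j]] by simp
    qed
  qed
  then have H_sub: "edges H \<subseteq> edges G" by (auto simp: H_def)
  have "verts H \<subseteq> verts G"
  proof
    fix v assume "v \<in> verts H"
    then obtain j where "j < 2 * k" "v = f j" by (auto simp: H_def)
    then have "v \<in> {x (j div 2), y (j div 2)}" by (auto simp: f_def)
    moreover have "{x (j div 2), y (j div 2)} \<in> edges G"
      using E[OF xy(1)[OF half[OF \<open>j < 2 * k\<close>]]] by blast
    ultimately show "v \<in> verts G" using assms(3) unfolding simple_graph_def by blast
  qed
  moreover have "simple_graph H"
  proof -
    have "card e = 2" if "e \<in> edges H" for e
      using that H_sub assms(3) by (auto simp: simple_graph_def)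
    moreover have "e \<subseteq> verts H" if "e \<in> edges H" for e
      using that C_sub by (auto simp: H_def)
    ultimately show ?thesis by (simp add: simple_graph_def) (simp add: H_def)
  qed
  ultimately have "subgraph H G" using H_sub by (simp add: subgraph_def)
  moreover have "isomorphic ?C H"
    unfolding isomorphic_def
  proof (intro exI conjI ballI)
    show "bij_betw f (verts ?C) (verts H)"
      using f_inj by (simp add: bij_betw_def H_def cycle_graph_def)
    fix u v assume "u \<in> verts ?C" "v \<in> verts ?C"
    then have uv: "{u, v} \<subseteq> {..<2 * k}" by (auto simp: cycle_graph_def)
    have "{f u, f v} = f ` e \<longleftrightarrow> {u, v} = e" if "e \<in> edges ?C" for e
      using inj_on_image_eq_iff[OF f_inj uv C_sub[OF that]] by simp
    then show "{u, v} \<in> edges ?C \<longleftrightarrow> {f u, f v} \<in> edges H"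
      by (auto simp: H_def)
  qed
  ultimately show ?thesis unfolding free_of_def by blast
qed

lemma distance_leD:
  assumes "distance G u v \<le> enat n"
  shows "\<exists>p. walk G u p v \<and> length p \<le> Suc n"
proof (rule ccontr)
  assume "\<not> ?thesis"
  then have "enat (Suc n) \<le> distance G u v"
    unfolding distance_def by (intro INF_greatest) (auto simp: not_le)
  then show False using assms by (metis Suc_n_not_le_n enat_ord_simps(1) order_trans)
qed

lemma edge_distance_le_2D:
  assumes "edge_distance G e f \<le> 2" "simple_graph G" "e \<in> edges G" "f \<in> edges G"
  shows "\<exists>g\<in>edges G. e \<inter> g \<noteq> {} \<and> g \<inter> f \<noteq> {}"
proof -
  have ne: "h \<noteq> {}" if "h \<in> edges G" for h
    using that assms(2) by (auto simp: simple_graph_def)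
  have meet: "h \<inter> h' \<noteq> {}" if "{h, h'} \<in> edges (line_graph G)" for h h'
    using that by (auto simp: line_graph_def doubleton_eq_iff)
  have "distance (line_graph G) e f \<le> enat 2"
    using assms(1) by (simp add: edge_distance_def numeral_eq_enat)
  from distance_leD[OF this] obtain p where p: "walk (line_graph G) e p f" "length p \<le> 3"
    by auto
  then consider "p = [e]" "e = f" | "p = [e, f]" | g where "p = [e, g, f]"
    by (cases p; cases "tl p"; cases "tl (tl p)") (auto simp: walk_def)
  then show ?thesis
  proof cases
    case 1
    then show ?thesis using assms ne by blast
  next
    case 2
    then have "e \<inter> f \<noteq> {}" using p meet by (simp add: walk_def)
    then show ?thesis using assms ne by blast
  next
    case 3
    then have "e \<inter> g \<noteq> {}" "g \<inter> f \<noteq> {}" "g \<in> verts (line_graph G)"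
      using p meet by (simp_all add: walk_def)
    then show ?thesis by (auto simp: line_graph_def)
  qed
qed

lemma degree_le_max_degree:
  assumes "finite (verts G)" "v \<in> verts G"
  shows "degree G v \<le> max_degree G"
  using assms by (simp add: max_degree_def)

theorem theorem1p9:
  fixes G :: "'a ugraph" and k :: nat
  assumes "k \<ge> 2"
    and "simple_graph G"
    and "bipartite G"
    and "free_of (cycle_graph (2 * k)) G"
    and "max_degree G \<ge> 1"
  shows "int (strong_clique_number G) \<le> int k * int (max_degree G) - (int k - 1)"
proof -
  obtain A B where AB: "A \<union> B = verts G" "A \<inter> B = {}"
    and edge: "\<And>e. e \<in> edges G \<Longrightarrow> \<exists>a\<in>A. \<exists>b\<in>B. e = {a, b}"
    using assms(3) by (auto simp: bipartite_def)
  define E where "E = {(a, b). a \<in> A \<and> b \<in> B \<and> {a, b} \<in> edges G}"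
  have finV: "finite (verts G)" using assms(2) by (simp add: simple_graph_def)
  have "edges G \<subseteq> Pow (verts G)" using assms(2) by (auto simp: simple_graph_def)
  then have finG: "finite (edges G)" using finV finite_subset by blast
  have "E \<subseteq> A \<times> B" by (auto simp: E_def)
  then have finE: "finite E"
    using finV AB(1) by (metis finite_SigmaI finite_Un finite_subset)
  have no: "\<not> even_cycle k E"
  proof
    assume "even_cycle k E"
    then have "\<not> free_of (cycle_graph (2 * k)) G"
      by (rule even_cycle_imp_not_free_of[OF _ AB(2) assms(2)]) (auto simp: E_def)
    then show False using assms(4) by blast
  qed
  have deg: "card N \<le> max_degree G" if "\<And>u. u \<in> N \<Longrightarrow> {v, u} \<in> edges G" for v N
  proof (cases "N = {}")
    case False
    then have "v \<in> verts G" using that \<open>edges G \<subseteq> Pow (verts G)\<close> by blast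
    have "inj_on (\<lambda>u. {v, u}) N" by (auto simp: inj_on_def doubleton_eq_iff)
    then have "card N \<le> degree G v"
      unfolding degree_def using that finG by (intro card_inj_on_le[of "\<lambda>u. {v, u}"]) auto
    then show ?thesis using degree_le_max_degree[OF finV \<open>v \<in> verts G\<close>] by linarith
  qed simp
  have bound: "card S + k \<le> k * max_degree G + 1" if S: "strong_clique G S" for S
  proof -
    define S' where "S' = {(a, b) \<in> E. {a, b} \<in> S}"
    have SG: "S \<subseteq> edges G" using S by (simp add: strong_clique_def)
    interpret strong_clique_rel E S' "max_degree G"
    proof
      show "finite E" by (fact finE)
      show "S' \<subseteq> E" by (auto simp: S'_def)
      show "card (E `` {a}) \<le> max_degree G" for a by (rule deg[of _ a]) (auto simp: E_def)
      show "card (E\<inverse> `` {b}) \<le> max_degree G" for b by (rule deg[of _ b]) (auto simp: E_def insert_commute)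
      fix a b a' b' assume ab: "(a, b) \<in> S'" "(a', b') \<in> S'"
      then have mem: "a \<in> A" "b \<in> B" "a' \<in> A" "b' \<in> B" "{a, b} \<in> S" "{a', b'} \<in> S"
        by (auto simp: S'_def E_def)
      then have "edge_distance G {a, b} {a', b'} \<le> 2" using S by (simp add: strong_clique_def)
      then obtain g where g: "g \<in> edges G" "{a, b} \<inter> g \<noteq> {}" "g \<inter> {a', b'} \<noteq> {}"
        using edge_distance_le_2D[of G "{a, b}" "{a', b'}"] assms(2) mem(5,6) SG by blast
      obtain c d where cd: "c \<in> A" "d \<in> B" "g = {c, d}" using edge[OF g(1)] by blast
      then have "a = c \<or> b = d" "c = a' \<or> d = b'" using g mem AB(2) by blast+
      moreover have "(c, d) \<in> E" using cd g(1) by (simp add: E_def)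
      moreover have "(a, b) \<in> E" "(a', b') \<in> E" using ab by (auto simp: S'_def)
      ultimately show "(a, b') \<in> E \<or> (a', b) \<in> E" by blast
    qed
    have "S \<subseteq> (\<lambda>(a, b). {a, b}) ` S'"
    proof
      fix e assume "e \<in> S"
      then obtain a b where "a \<in> A" "b \<in> B" "e = {a, b}" using edge SG by blast
      then have "(a, b) \<in> S'" using \<open>e \<in> S\<close> SG by (auto simp: S'_def E_def)
      then show "e \<in> (\<lambda>(a, b). {a, b}) ` S'" using \<open>e = {a, b}\<close> by force
    qed
    then have "card S \<le> card S'" by (rule surj_card_le[OF finS])
    then show ?thesis using card_le_if_no_even_cycle[OF assms(1,5) no] by linarith
  qed
  have "{S. strong_clique G S} \<subseteq> Pow (edges G)" by (auto simp: strong_clique_def)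
  then have "finite {S. strong_clique G S}" using finG finite_subset by blast
  moreover have "strong_clique G {}" by (simp add: strong_clique_def)
  ultimately have "strong_clique_number G \<in> card ` {S. strong_clique G S}"
    unfolding strong_clique_number_def by (intro Max_in) auto
  then have "strong_clique_number G + k \<le> k * max_degree G + 1" using bound by auto
  then have "int (strong_clique_number G + k) \<le> int (k * max_degree G + 1)" by (simp only: of_nat_le_iff)
  then show ?thesis by simp
qed

end
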